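(* Let $0<K<\sigma$ and $d\ge1$. For any $K$-subgaussian distribution $\mathbb{P}$ on $\mathbb{R}^d$ we have $I_{\chi^2}(S;Y)<\infty$, where $S\sim\mathbb{P}$ and $Z\sim\mathcal{N}(0,\sigma^2I_d)$ are independent and $Y=S+Z$.
   Context: A probability distribution $\mathbb{P}$ on $\mathbb{R}^d$ is $K$-subgaussian if, for $X\sim\mathbb{P}$, $\mathbb{E}[e^{\langle\lambda, X-\mathbb{E}[X]\rangle}]\le e^{\frac12K^2\|\lambda\|^2}$ for all $\lambda\in\mathbb{R}^d$. The $\chi^2$-mutual information is $I_{\chi^2}(S;Y)=\chi^2(P_{S,Y}\|P_S\otimes P_Y)$, where $\chi^2(P\|Q)=\int\left(\frac{dP}{dQ}\right)^2dQ-1$. *)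

theory Defs
  imports "HOL-Probability.Probability"
begin

text \<open>
  The moment generating function is taken as a nonnegative Lebesgue integral, so the bound
  also asserts its finiteness.
\<close>

definition subgaussian :: "real \<Rightarrow> 'a::euclidean_space measure \<Rightarrow> bool" where
  "subgaussian K P \<longleftrightarrow>
     prob_space P \<and> sets P = sets borel \<and> integrable P (\<lambda>x. x) \<and>
     (\<forall>u. (\<integral>\<^sup>+ x. ennreal (exp (u \<bullet> (x - (\<integral>y. y \<partial>P)))) \<partial>P)
            \<le> ennreal (exp (1 / 2 * K\<^sup>2 * (norm u)\<^sup>2)))"

text \<open>The isotropic Gaussian: its coordinates are independent centred normals of
  standard deviation \<open>\<sigma>\<close>.\<close>

definition isotropic_gaussian :: "real \<Rightarrow> 'a::euclidean_space measure" where
  "isotropic_gaussian \<sigma> =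
     density lborel (\<lambda>x. ennreal (\<Prod>b\<in>Basis. normal_density 0 \<sigma> (x \<bullet> b)))"

text \<open>
  The formula presupposes that \<open>dP/dQ\<close> exists; as usual the divergence is infinite when
  \<open>P\<close> is not absolutely continuous with respect to \<open>Q\<close>. The order of the arguments is that
  of the notation \<open>\<chi>\<^sup>2(P \<parallel> Q)\<close>, opposite to \<open>KL_divergence\<close>.
\<close>

definition chi2_divergence :: "'a measure \<Rightarrow> 'a measure \<Rightarrow> ereal" where
  "chi2_divergence P Q =
     (if absolutely_continuous Q P
      then enn2ereal (\<integral>\<^sup>+ x. (RN_deriv Q P x)\<^sup>2 \<partial>Q) - 1
      else \<infinity>)"

definition chi2_mutual_information ::
  "'m measure \<Rightarrow> 'a measure \<Rightarrow> 'b measure \<Rightarrow> ('m \<Rightarrow> 'a) \<Rightarrow> ('m \<Rightarrow> 'b) \<Rightarrow> ereal" where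
  "chi2_mutual_information M A B X Y =
     chi2_divergence (distr M (A \<Otimes>\<^sub>M B) (\<lambda>w. (X w, Y w)))
                     (distr M A X \<Otimes>\<^sub>M distr M B Y)"

end

theory Submission
  imports Defs
begin

text \<open>
  Let \<open>g\<close> be the density of the noise. The joint law of \<open>(S, Y)\<close> has density \<open>g (y - s)\<close>
  with respect to \<open>P \<Otimes> lborel\<close>, and \<open>Y\<close> has the mixture density \<open>p y = E (g (y - S))\<close>, so
  \<^verbatim>\<open>I(S; Y) + 1 = (integral of E (g (y - S)^2) / E (g (y - S)) over y)\<close>;
  this is \<open>chi2_mutual_information_additive_noise\<close>. It remains to see that the integrand decays
  like a Gaussian, which is \<open>gaussian_mixture_ratio_bound\<close>.

  Write \<open>\<gamma> x = exp (- a \<bar>x\<bar>\<^sup>2)\<close> with \<open>a = 1 / (2 \<sigma>\<^sup>2)\<close>, let \<open>r\<close> be the distance of \<open>y\<close> from the mean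
  of \<open>P\<close>, and put \<open>w = exp (- \<delta> r\<^sup>2)\<close>. Where \<open>\<gamma> \<le> w\<close>, one has \<open>\<gamma>\<^sup>2 \<le> w \<gamma>\<close>, and this part
  contributes at most \<open>w\<close> to the ratio, whatever the size of the denominator. Where \<open>\<gamma> > w\<close>, one
  trades \<open>\<gamma>\<^sup>2\<close> for a high power \<open>\<gamma>\<^sup>N w\<^sup>2\<^sup>-\<^sup>N\<close>. A high power of \<open>\<gamma>\<close> is a narrow bump, so
  its mean \<open>E (\<gamma> (y - S)\<^sup>N)\<close> measures the probability that \<open>S\<close> lies near \<open>y\<close>, which a
  \<open>K\<close>-subgaussian law bounds by nearly \<open>exp (- r\<^sup>2 / (2 K\<^sup>2))\<close>. The denominator, in turn, is at least
  of order \<open>exp (- b r\<^sup>2)\<close> for any \<open>b > a\<close>, because some ball carries positive mass. As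
  \<open>1 / (2 K\<^sup>2) > 1 / (2 \<sigma>\<^sup>2) = a\<close>, the numerator wins once \<open>N\<close> is large, with room
  left to absorb the factor \<open>w\<^sup>2\<^sup>-\<^sup>N\<close> when \<open>\<delta>\<close> is small. Bounding \<open>\<gamma>\<^sup>2\<close> directly against the lower bound
  of the denominator (the case \<open>N = 2\<close>) would need a smaller \<open>K\<close>; the cut-off is what gives
  the full range \<open>K < \<sigma>\<close>.
\<close>

section \<open>Chi-squared information of an additive noise channel\<close>

lemma (in prob_space) nn_integral_pos:
  assumes f: "f \<in> borel_measurable M" and pos: "\<And>x. 0 < f x"
  shows "0 < (\<integral>\<^sup>+ x. f x \<partial>M)"
proof (rule ccontr)
  assume "\<not> 0 < (\<integral>\<^sup>+ x. f x \<partial>M)"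
  then have "AE x in M. f x = 0"
    using f by (simp add: nn_integral_0_iff_AE)
  then show False
    using pos by (simp add: less_le AE_False)
qed

text \<open>
  Adding \<open>s\<close> to noise with density \<open>g\<close> translates the density. Stated for the joint law of input and
  output, this covers the numerator of the Radon-Nikodym derivative, and its second marginal is the
  law of the output.
\<close>

lemma distr_shear_density:
  fixes P :: "'a::euclidean_space measure" and g :: "'a \<Rightarrow> ennreal"
  assumes sets[measurable_cong]: "sets P = sets borel"
    and g[measurable]: "g \<in> borel_measurable borel"
    and G: "sigma_finite_measure (density lborel g)"
  shows "distr (P \<Otimes>\<^sub>M density lborel g) (borel \<Otimes>\<^sub>M borel) (\<lambda>(s, z). (s, s + z))
    = density (P \<Otimes>\<^sub>M lborel) (\<lambda>(s, y). g (y - s))"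
proof (rule measure_eqI)
  show "sets (distr (P \<Otimes>\<^sub>M density lborel g) (borel \<Otimes>\<^sub>M borel) (\<lambda>(s, z). (s, s + z)))
    = sets (density (P \<Otimes>\<^sub>M lborel) (\<lambda>(s, y). g (y - s)))"
    by (simp add: sets cong: sets_pair_measure_cong)
next
  fix X assume "X \<in> sets (distr (P \<Otimes>\<^sub>M density lborel g) (borel \<Otimes>\<^sub>M borel) (\<lambda>(s, z). (s, s + z)))"
  then have X[measurable]: "X \<in> sets (borel \<Otimes>\<^sub>M borel)" by simp
  then have X'[measurable]: "X \<in> sets (P \<Otimes>\<^sub>M lborel)"
    by (simp add: sets cong: sets_pair_measure_cong)
  have translate: "(\<integral>\<^sup>+ z. g z * indicator X (s, s + z) \<partial>lborel)
      = (\<integral>\<^sup>+ y. g (y - s) * indicator X (s, y) \<partial>lborel)" for s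
  proof -
    have "(\<integral>\<^sup>+ y. g (y - s) * indicator X (s, y) \<partial>lborel)
        = (\<integral>\<^sup>+ y. g (y - s) * indicator X (s, y) \<partial>distr lborel borel ((+) s))"
      by (simp add: lborel_distr_plus)
    also have "\<dots> = (\<integral>\<^sup>+ z. g z * indicator X (s, s + z) \<partial>lborel)"
      by (subst nn_integral_distr) auto
    finally show ?thesis ..
  qed
  have "emeasure (distr (P \<Otimes>\<^sub>M density lborel g) (borel \<Otimes>\<^sub>M borel) (\<lambda>(s, z). (s, s + z))) X
      = (\<integral>\<^sup>+ w. indicator X w \<partial>distr (P \<Otimes>\<^sub>M density lborel g) (borel \<Otimes>\<^sub>M borel) (\<lambda>(s, z). (s, s + z)))"
    by simp
  also have "\<dots> = (\<integral>\<^sup>+ w. indicator X (fst w, fst w + snd w) \<partial>(P \<Otimes>\<^sub>M density lborel g))"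
    by (subst nn_integral_distr) (auto simp: case_prod_beta)
  also have "\<dots> = (\<integral>\<^sup>+ s. \<integral>\<^sup>+ z. indicator X (s, s + z) \<partial>density lborel g \<partial>P)"
    by (subst sigma_finite_measure.nn_integral_fst[OF G, symmetric]) auto
  also have "\<dots> = (\<integral>\<^sup>+ s. \<integral>\<^sup>+ z. g z * indicator X (s, s + z) \<partial>lborel \<partial>P)"
    by (subst nn_integral_density) auto
  also have "\<dots> = (\<integral>\<^sup>+ s. \<integral>\<^sup>+ y. g (y - s) * indicator X (s, y) \<partial>lborel \<partial>P)"
    by (simp add: translate)
  also have "\<dots> = (\<integral>\<^sup>+ w. g (snd w - fst w) * indicator X w \<partial>(P \<Otimes>\<^sub>M lborel))"
    by (subst lborel.nn_integral_fst[symmetric]) auto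
  also have "\<dots> = emeasure (density (P \<Otimes>\<^sub>M lborel) (\<lambda>(s, y). g (y - s))) X"
    by (subst emeasure_density) (auto simp: case_prod_beta)
  finally show "emeasure (distr (P \<Otimes>\<^sub>M density lborel g) (borel \<Otimes>\<^sub>M borel) (\<lambda>(s, z). (s, s + z))) X
      = emeasure (density (P \<Otimes>\<^sub>M lborel) (\<lambda>(s, y). g (y - s))) X" .
qed

lemma distr_snd_density:
  assumes P: "sigma_finite_measure P" and L: "sigma_finite_measure L"
    and f[measurable]: "case_prod f \<in> borel_measurable (P \<Otimes>\<^sub>M L)"
  shows "distr (density (P \<Otimes>\<^sub>M L) (case_prod f)) L snd = density L (\<lambda>y. \<integral>\<^sup>+ s. f s y \<partial>P)"
proof (rule measure_eqI)
  interpret P: sigma_finite_measure P by fact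
  interpret L: sigma_finite_measure L by fact
  interpret pair_sigma_finite P L ..
  fix X assume "X \<in> sets (distr (density (P \<Otimes>\<^sub>M L) (case_prod f)) L snd)"
  then have X[measurable]: "X \<in> sets L" by simp
  have "emeasure (distr (density (P \<Otimes>\<^sub>M L) (case_prod f)) L snd) X
      = (\<integral>\<^sup>+ w. indicator X w \<partial>(distr (density (P \<Otimes>\<^sub>M L) (case_prod f)) L snd))"
    by simp
  also have "\<dots> = (\<integral>\<^sup>+ w. case_prod f w * indicator X (snd w) \<partial>(P \<Otimes>\<^sub>M L))"
    by (subst nn_integral_distr) (auto simp: nn_integral_density)
  also have "\<dots> = (\<integral>\<^sup>+ y. \<integral>\<^sup>+ s. f s y * indicator X y \<partial>P \<partial>L)"
    by (subst nn_integral_snd[symmetric]) auto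
  also have "\<dots> = (\<integral>\<^sup>+ y. (\<integral>\<^sup>+ s. f s y \<partial>P) * indicator X y \<partial>L)"
    by (intro nn_integral_cong nn_integral_multc) measurable
  also have "\<dots> = emeasure (density L (\<lambda>y. \<integral>\<^sup>+ s. f s y \<partial>P)) X"
    by (subst emeasure_density) auto
  finally show "emeasure (distr (density (P \<Otimes>\<^sub>M L) (case_prod f)) L snd) X
    = emeasure (density L (\<lambda>y. \<integral>\<^sup>+ s. f s y \<partial>P)) X" .
qed simp

text \<open>
  The divergence is defined through \<open>RN_deriv\<close>, an unspecified version of the derivative; any
  explicit density may replace it because the two agree almost everywhere.
\<close>

lemma chi2_divergence_density:
  assumes Q: "sigma_finite_measure Q" and f: "f \<in> borel_measurable Q"
  shows "chi2_divergence (density Q f) Q = enn2ereal (\<integral>\<^sup>+ x. (f x)\<^sup>2 \<partial>Q) - 1"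
proof -
  have "AE x in Q. f x = RN_deriv Q (density Q f) x"
    using sigma_finite_measure.RN_deriv_unique[OF Q f refl] .
  then have "(\<integral>\<^sup>+ x. (RN_deriv Q (density Q f) x)\<^sup>2 \<partial>Q) = (\<integral>\<^sup>+ x. (f x)\<^sup>2 \<partial>Q)"
    by (intro nn_integral_cong_AE) auto
  then show ?thesis
    using absolutely_continuousI_density[OF f] by (simp add: chi2_divergence_def)
qed

text \<open>
  With respect to the product of the marginals the joint law has density \<open>g (y - s) / p y\<close>. The
  division is harmless since \<open>p\<close> lies strictly between \<open>0\<close> and \<open>\<infinity>\<close>, which is
  what positivity and boundedness of \<open>g\<close> are for. Integrating the square against \<open>p y dP dy\<close>
  cancels one factor \<open>p y\<close>.
\<close>

lemma chi2_mutual_information_additive_noise: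
  fixes S Z :: "'m \<Rightarrow> 'a::euclidean_space" and g :: "'a \<Rightarrow> ennreal"
  assumes M: "prob_space M"
    and indep: "prob_space.indep_var M borel S borel Z"
    and S: "distr M borel S = P"
    and Z: "distr M borel Z = density lborel g"
    and g[measurable]: "g \<in> borel_measurable borel"
    and pos: "\<And>x. 0 < g x" and bound: "\<And>x. g x \<le> C" and C: "C < \<infinity>"
  shows "chi2_mutual_information M borel borel S (\<lambda>w. S w + Z w) =
    enn2ereal (\<integral>\<^sup>+ y. (\<integral>\<^sup>+ s. (g (y - s))\<^sup>2 \<partial>P) / (\<integral>\<^sup>+ s. g (y - s) \<partial>P) \<partial>lborel) - 1"
proof -
  interpret M: prob_space M by fact
  have S_rv[measurable]: "S \<in> borel_measurable M" and Z_rv[measurable]: "Z \<in> borel_measurable M"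
    and joint: "distr M (borel \<Otimes>\<^sub>M borel) (\<lambda>w. (S w, Z w)) = distr M borel S \<Otimes>\<^sub>M distr M borel Z"
    using indep unfolding M.indep_var_distribution_eq by auto
  interpret P: prob_space P
    unfolding S[symmetric] by (rule M.prob_space_distr) simp
  interpret G: prob_space "density lborel g"
    unfolding Z[symmetric] by (rule M.prob_space_distr) simp
  have sets[measurable_cong]: "sets P = sets borel"
    unfolding S[symmetric] by simp
  interpret PL: pair_sigma_finite P lborel ..
  let ?Y = "\<lambda>w. S w + Z w"
  define p where "p y = (\<integral>\<^sup>+ s. g (y - s) \<partial>P)" for y
  have p_measurable[measurable]: "p \<in> borel_measurable borel"
    unfolding p_def by measurable
  have p_fin: "p y \<noteq> \<infinity>" for y
  proof -
    have "p y \<le> (\<integral>\<^sup>+ s. C \<partial>P)"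
      unfolding p_def by (intro nn_integral_mono bound)
    also have "\<dots> < \<infinity>"
      using C by (simp add: P.emeasure_space_1)
    finally show ?thesis by simp
  qed
  have p_pos: "p y \<noteq> 0" for y
    using P.nn_integral_pos[of "\<lambda>s. g (y - s)"] pos unfolding p_def by simp
  have J: "distr M (borel \<Otimes>\<^sub>M borel) (\<lambda>w. (S w, ?Y w)) = density (P \<Otimes>\<^sub>M lborel) (\<lambda>(s, y). g (y - s))"
  proof -
    have "distr M (borel \<Otimes>\<^sub>M borel) (\<lambda>w. (S w, ?Y w))
        = distr (distr M (borel \<Otimes>\<^sub>M borel) (\<lambda>w. (S w, Z w))) (borel \<Otimes>\<^sub>M borel) (\<lambda>(s, z). (s, s + z))"
      by (subst distr_distr) (auto simp: comp_def)
    also have "\<dots> = density (P \<Otimes>\<^sub>M lborel) (\<lambda>(s, y). g (y - s))"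
      unfolding joint S Z
      by (rule distr_shear_density) (auto simp: sets G.sigma_finite_measure_axioms)
    finally show ?thesis .
  qed
  have Y: "distr M borel ?Y = density lborel p"
  proof -
    have "distr M borel ?Y = distr (distr M (borel \<Otimes>\<^sub>M borel) (\<lambda>w. (S w, ?Y w))) lborel snd"
      by (subst distr_distr) (auto simp: comp_def intro!: distr_cong)
    also have "\<dots> = density lborel p"
      unfolding J p_def
      by (rule distr_snd_density) (auto simp: P.sigma_finite_measure_axioms lborel.sigma_finite_measure_axioms)
    finally show ?thesis .
  qed
  interpret Y: prob_space "density lborel p"
    unfolding Y[symmetric] by (rule M.prob_space_distr) simp
  define Q where "Q = P \<Otimes>\<^sub>M density lborel p"
  have Q_density: "Q = density (P \<Otimes>\<^sub>M lborel) (\<lambda>(s, y). p y)"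
    using pair_measure_density[of "\<lambda>_. 1" P p lborel]
    by (simp add: Q_def density_1 lborel.sigma_finite_measure_axioms Y.sigma_finite_measure_axioms)
  interpret Q: pair_prob_space P "density lborel p" ..
  define f where "f = (\<lambda>(s, y). g (y - s) / p y)"
  have f_measurable[measurable]: "f \<in> borel_measurable (P \<Otimes>\<^sub>M lborel)"
    unfolding f_def by measurable
  have f_Q: "f \<in> borel_measurable Q"
    unfolding Q_density by measurable
  have cancel: "p y * (g x / p y) = g x" for x y
    using p_pos[of y] p_fin[of y] by (simp add: ennreal_times_divide ennreal_mult_divide_eq mult.commute)
  have "density Q f = density (P \<Otimes>\<^sub>M lborel) (\<lambda>(s, y). g (y - s))"
    unfolding Q_density
    by (subst density_density_eq) (auto simp: f_def case_prod_beta' cancel)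
  then have "chi2_mutual_information M borel borel S ?Y = chi2_divergence (density Q f) Q"
    by (simp add: chi2_mutual_information_def J Y S Q_def)
  also have "\<dots> = enn2ereal (\<integral>\<^sup>+ x. (f x)\<^sup>2 \<partial>Q) - 1"
    using Q.sigma_finite_measure_axioms f_Q by (intro chi2_divergence_density) (auto simp: Q_def)
  also have "(\<integral>\<^sup>+ x. (f x)\<^sup>2 \<partial>Q) = (\<integral>\<^sup>+ x. p (snd x) * (f x)\<^sup>2 \<partial>(P \<Otimes>\<^sub>M lborel))"
    unfolding Q_density by (subst nn_integral_density) (auto simp: case_prod_beta)
  also have "\<dots> = (\<integral>\<^sup>+ y. \<integral>\<^sup>+ s. p y * (f (s, y))\<^sup>2 \<partial>P \<partial>lborel)"
    by (subst PL.nn_integral_snd[symmetric]) auto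
  also have "\<dots> = (\<integral>\<^sup>+ y. \<integral>\<^sup>+ s. (g (y - s))\<^sup>2 / p y \<partial>P \<partial>lborel)"
  proof (intro nn_integral_cong)
    fix y s
    have "p y * (f (s, y))\<^sup>2 = (p y * (g (y - s) / p y)) * (g (y - s) / p y)"
      by (simp add: f_def power2_eq_square mult.assoc)
    also have "\<dots> = (g (y - s))\<^sup>2 / p y"
      unfolding cancel by (simp add: ennreal_times_divide power2_eq_square)
    finally show "p y * (f (s, y))\<^sup>2 = (g (y - s))\<^sup>2 / p y" .
  qed
  also have "\<dots> = (\<integral>\<^sup>+ y. (\<integral>\<^sup>+ s. (g (y - s))\<^sup>2 \<partial>P) / p y \<partial>lborel)"
    by (intro nn_integral_cong nn_integral_divide) measurable
  finally show ?thesis unfolding p_def .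
qed

section \<open>Gaussian integrals\<close>

lemma prod_normal_density_eq:
  fixes x :: "'a::euclidean_space"
  shows "(\<Prod>b\<in>Basis. normal_density 0 \<sigma> (x \<bullet> b)) =
    (1 / sqrt (2 * pi * \<sigma>\<^sup>2)) ^ DIM('a) * exp (- (1 / (2 * \<sigma>\<^sup>2)) * (norm x)\<^sup>2)"
proof -
  have "(norm x)\<^sup>2 = (\<Sum>b\<in>Basis. (x \<bullet> b)\<^sup>2)"
    by (subst power2_norm_eq_inner, subst euclidean_inner) (simp add: power2_eq_square)
  then have "(\<Prod>b\<in>Basis. exp (- (x \<bullet> b)\<^sup>2 / (2 * \<sigma>\<^sup>2))) = exp (- (1 / (2 * \<sigma>\<^sup>2)) * (norm x)\<^sup>2)"
    by (simp add: exp_sum[symmetric] sum_divide_distrib sum_negf)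
  then show ?thesis
    by (simp add: normal_density_def prod_dividef power_one_over)
qed

text \<open>
  Up to a constant the integrand is the product of centred normal densities of variance
  \<open>1 / (2 \<delta>)\<close> in the coordinates, translated by \<open>m\<close>.
\<close>

lemma nn_integral_exp_neg_norm_sq_finite:
  fixes m :: "'a::euclidean_space"
  assumes "0 < \<delta>"
  shows "(\<integral>\<^sup>+ y. ennreal (exp (- \<delta> * (norm (y - m))\<^sup>2)) \<partial>lborel) < \<infinity>"
proof -
  define \<tau> where "\<tau> = 1 / sqrt (2 * \<delta>)"
  define c where "c = (1 / sqrt (2 * pi * \<tau>\<^sup>2)) ^ DIM('a)"
  have \<tau>: "\<tau> > 0" "1 / (2 * \<tau>\<^sup>2) = \<delta>"
    using assms by (auto simp: \<tau>_def power_divide)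
  have c: "c > 0"
    using \<tau> by (simp add: c_def)
  have one: "(\<integral>\<^sup>+ t. ennreal (normal_density 0 \<tau> t) \<partial>lborel) = 1"
    using \<tau> by (subst nn_integral_eq_integral) auto
  have "ennreal c * (\<integral>\<^sup>+ x. ennreal (exp (- \<delta> * (norm x)\<^sup>2)) \<partial>(lborel :: 'a measure))
      = (\<integral>\<^sup>+ x. (\<Prod>b\<in>Basis. ennreal (normal_density 0 \<tau> (x \<bullet> b))) \<partial>(lborel :: 'a measure))"
    using c by (subst nn_integral_cmult[symmetric])
      (auto simp: prod_ennreal prod_normal_density_eq \<tau>(2) c_def ennreal_mult' simp del: ennreal_power)
  also have "\<dots> = 1"
    by (subst nn_integral_lborel_prod) (auto simp: one)
  finally have fin: "(\<integral>\<^sup>+ x. ennreal (exp (- \<delta> * (norm x)\<^sup>2)) \<partial>(lborel :: 'a measure)) < \<infinity>"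
    using c by (auto simp: less_top[symmetric] ennreal_mult_top)
  have "(\<integral>\<^sup>+ y. ennreal (exp (- \<delta> * (norm (y - m))\<^sup>2)) \<partial>lborel)
      = (\<integral>\<^sup>+ y. ennreal (exp (- \<delta> * (norm (y - m))\<^sup>2)) \<partial>distr lborel borel ((+) m))"
    by (simp add: lborel_distr_plus)
  also have "\<dots> = (\<integral>\<^sup>+ x. ennreal (exp (- \<delta> * (norm x)\<^sup>2)) \<partial>(lborel :: 'a measure))"
    by (subst nn_integral_distr) auto
  finally show ?thesis using fin by simp
qed

section \<open>Gaussian averages of subgaussian laws\<close>

text \<open>
  A Gaussian is dominated by each of its exponential tangents: completing the square gives
  \<open>- t \<bar>x\<bar>\<^sup>2 \<le> - u \<bullet> x + \<bar>u\<bar>\<^sup>2 / (4 t)\<close>, and the exponential of the right-hand side has a mean that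
  the subgaussian hypothesis controls. The bound follows by optimising over the slope \<open>u\<close>. As \<open>t\<close>
  grows, the rate tends to the subgaussian tail rate \<open>1 / (2 K\<^sup>2)\<close>.
\<close>

lemma subgaussian_exp_neg_norm_sq_le:
  fixes P :: "'a::euclidean_space measure"
  assumes sub: "subgaussian K P" and t: "0 < t"
  shows "(\<integral>\<^sup>+ s. ennreal (exp (- t * (norm (y - s))\<^sup>2)) \<partial>P)
    \<le> ennreal (exp (- (1 / (2 * K\<^sup>2 + 1 / t)) * (norm (y - (\<integral>x. x \<partial>P)))\<^sup>2))"
proof -
  have sets[measurable_cong]: "sets P = sets borel"
    using sub by (simp add: subgaussian_def)
  define m where "m = (\<integral>x. x \<partial>P)"
  \<comment> \<open>The slope \<open>u\<close> minimises the final exponent, a quadratic polynomial in \<open>k\<close>.\<close>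
  define k where "k = 2 / (2 * K\<^sup>2 + 1 / t)"
  define u where "u = k *\<^sub>R (y - m)"
  define c where "c = (norm u)\<^sup>2 / (4 * t) - u \<bullet> (y - m)"
  have den: "2 * K\<^sup>2 + 1 / t > 0"
    using t by (intro add_nonneg_pos) auto
  have square: "- t * (norm (y - s))\<^sup>2 \<le> u \<bullet> (s - m) + c" for s
  proof -
    have expand: "(norm (x - r *\<^sub>R u))\<^sup>2 = (norm x)\<^sup>2 - 2 * r * (u \<bullet> x) + r\<^sup>2 * (norm u)\<^sup>2" for x r
      unfolding power2_norm_eq_inner
      by (simp add: inner_diff inner_commute[of x u] power2_eq_square algebra_simps)
    have "0 \<le> t * (norm ((y - s) - (1 / (2 * t)) *\<^sub>R u))\<^sup>2"
      using t by simp
    also have "\<dots> = t * (norm (y - s))\<^sup>2 - u \<bullet> (y - s) + (norm u)\<^sup>2 / (4 * t)"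
      unfolding expand using t by (simp add: field_simps power2_eq_square)
    finally show ?thesis
      by (simp add: c_def inner_diff)
  qed
  have "(\<integral>\<^sup>+ s. ennreal (exp (- t * (norm (y - s))\<^sup>2)) \<partial>P)
      \<le> (\<integral>\<^sup>+ s. ennreal (exp c) * ennreal (exp (u \<bullet> (s - m))) \<partial>P)"
    using square by (intro nn_integral_mono) (auto simp: ennreal_mult'[symmetric] exp_add[symmetric] add.commute)
  also have "\<dots> = ennreal (exp c) * (\<integral>\<^sup>+ s. ennreal (exp (u \<bullet> (s - m))) \<partial>P)"
    by (intro nn_integral_cmult) measurable
  also have "\<dots> \<le> ennreal (exp c) * ennreal (exp (1 / 2 * K\<^sup>2 * (norm u)\<^sup>2))"
    using sub by (intro mult_left_mono) (auto simp: subgaussian_def m_def)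
  also have "\<dots> = ennreal (exp (c + 1 / 2 * K\<^sup>2 * (norm u)\<^sup>2))"
    by (simp add: ennreal_mult'[symmetric] exp_add)
  also have "c + 1 / 2 * K\<^sup>2 * (norm u)\<^sup>2 = (k\<^sup>2 * (2 * K\<^sup>2 + 1 / t) / 4 - k) * (norm (y - m))\<^sup>2"
  proof -
    have "(norm u)\<^sup>2 = k\<^sup>2 * (norm (y - m))\<^sup>2" "u \<bullet> (y - m) = k * (norm (y - m))\<^sup>2"
      by (simp_all add: u_def power_mult_distrib power2_norm_eq_inner del: scaleR_diff_right)
    then show ?thesis
      using t by (simp add: c_def field_simps)
  qed
  also have "k\<^sup>2 * (2 * K\<^sup>2 + 1 / t) / 4 - k = - (1 / (2 * K\<^sup>2 + 1 / t))"
  proof -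
    have "k * (2 * K\<^sup>2 + 1 / t) = 2"
      using den unfolding k_def by (metis less_irrefl nonzero_eq_divide_eq)
    then have k_sq: "k\<^sup>2 * (2 * K\<^sup>2 + 1 / t) = 2 * k"
      by (simp only: power2_eq_square[of k] mult.assoc mult.commute[of 2])
    have "1 / E = (2 / E) / 2" for E :: real
      by simp
    then have k_half: "1 / (2 * K\<^sup>2 + 1 / t) = k / 2"
      unfolding k_def .
    show ?thesis unfolding k_sq k_half by simp
  qed
  finally show ?thesis by (simp add: m_def)
qed

text \<open>
  Some ball around \<open>m\<close> has positive mass, and seen from far away its points are all at about the
  distance of \<open>m\<close>; the slack between \<open>a\<close> and \<open>b\<close> pays for the radius.
\<close>

lemma exp_neg_norm_sq_integral_ge:
  fixes P :: "'a::euclidean_space measure"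
  assumes P: "prob_space P" and sets[measurable_cong]: "sets P = sets borel" and ab: "0 < a" "a < b"
  obtains q where "0 < q" and
    "\<And>y. ennreal (q * exp (- b * (norm (y - m))\<^sup>2)) \<le> (\<integral>\<^sup>+ s. ennreal (exp (- a * (norm (y - s))\<^sup>2)) \<partial>P)"
proof -
  interpret prob_space P by fact
  have space: "space P = UNIV"
    using sets_eq_imp_space_eq[OF sets] by simp
  have "(\<Union>n. cball m (real n)) = (UNIV :: 'a set)"
    by (auto simp: real_arch_simple)
  moreover have "emeasure P UNIV = 1"
    using emeasure_space_1 space by simp
  ultimately obtain n where n: "emeasure P (cball m (real n)) \<noteq> 0"
    using emeasure_UN_eq_0[of P "\<lambda>n. cball m (real n)"] by (auto simp: sets image_subset_iff)
  define R where "R = real n"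
  define e where "e = b / a - 1"
  have e: "e > 0" "b = a * (1 + e)"
    using ab by (auto simp: e_def)
  define d where "d = a * (1 + 1 / e) * R\<^sup>2"
  define q where "q = measure P (cball m R) * exp (- d)"
  have "q > 0"
    using n by (simp add: q_def R_def emeasure_eq_measure zero_less_measure_iff)
  moreover have "ennreal (q * exp (- b * (norm (y - m))\<^sup>2)) \<le> (\<integral>\<^sup>+ s. ennreal (exp (- a * (norm (y - s))\<^sup>2)) \<partial>P)" for y
  proof -
    have ball: "- d - b * (norm (y - m))\<^sup>2 \<le> - a * (norm (y - s))\<^sup>2" if "s \<in> cball m R" for s
    proof -
      have "norm (y - s) \<le> norm (y - m) + R"
        using that norm_triangle_ineq[of "y - m" "m - s"] by (simp add: dist_norm)
      then have "(norm (y - s))\<^sup>2 \<le> (norm (y - m) + R)\<^sup>2"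
        by (intro power_mono) auto
      also have "\<dots> \<le> (1 + e) * (norm (y - m))\<^sup>2 + (1 + 1 / e) * R\<^sup>2"
      proof -
        \<comment> \<open>Young's inequality \<open>2 x R \<le> e x\<^sup>2 + R\<^sup>2 / e\<close> for the mixed term.\<close>
        have "0 \<le> (e * norm (y - m) - R)\<^sup>2 / e"
          using e by simp
        also have "\<dots> = (1 + e) * (norm (y - m))\<^sup>2 + (1 + 1 / e) * R\<^sup>2 - (norm (y - m) + R)\<^sup>2"
          using e by (simp add: field_simps power2_eq_square)
        finally show ?thesis by simp
      qed
      finally have "a * (norm (y - s))\<^sup>2 \<le> a * ((1 + e) * (norm (y - m))\<^sup>2 + (1 + 1 / e) * R\<^sup>2)"
        using ab by (intro mult_left_mono) auto
      also have "\<dots> = d + b * (norm (y - m))\<^sup>2"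
        by (simp add: d_def e(2) algebra_simps)
      finally show ?thesis by simp
    qed
    have "ennreal (q * exp (- b * (norm (y - m))\<^sup>2))
        = ennreal (exp (- d - b * (norm (y - m))\<^sup>2)) * emeasure P (cball m R)"
      by (simp add: q_def emeasure_eq_measure ennreal_mult'[symmetric] exp_diff exp_minus field_simps)
    also have "\<dots> = (\<integral>\<^sup>+ s. ennreal (exp (- d - b * (norm (y - m))\<^sup>2)) * indicator (cball m R) s \<partial>P)"
      by (subst nn_integral_cmult_indicator) (auto simp: sets)
    also have "\<dots> \<le> (\<integral>\<^sup>+ s. ennreal (exp (- a * (norm (y - s))\<^sup>2)) \<partial>P)"
      using ball by (intro nn_integral_mono) (auto split: split_indicator)
    finally show ?thesis .
  qed
  ultimately show ?thesis using that by blast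
qed

text \<open>
  The cut-off in exponential form: with \<open>\<gamma> = exp (- A)\<close> and \<open>w = exp (- W)\<close> it reads
  \<open>\<gamma>\<^sup>2 \<le> w \<gamma> + w\<^sup>2\<^sup>-\<^sup>N \<gamma>\<^sup>N\<close>. The first summand suffices if \<open>\<gamma> \<le> w\<close>, the second otherwise.
\<close>

lemma exp_cutoff_le:
  fixes A W N :: real
  assumes "2 \<le> N"
  shows "exp (- 2 * A) \<le> exp (- W) * exp (- A) + exp ((N - 2) * W) * exp (- N * A)"
proof (cases "W \<le> A")
  case True
  then have "exp (- 2 * A) \<le> exp (- W + - A)" by simp
  then have "exp (- 2 * A) \<le> exp (- W) * exp (- A)" unfolding exp_add .
  then show ?thesis by (intro add_increasing2) auto
next
  case False
  then have "0 \<le> (N - 2) * (W - A)"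
    using assms by (intro mult_nonneg_nonneg) auto
  then have "exp (- 2 * A) \<le> exp ((N - 2) * W + - N * A)" by (simp add: algebra_simps)
  then have "exp (- 2 * A) \<le> exp ((N - 2) * W) * exp (- N * A)" unfolding exp_add .
  then show ?thesis by (intro add_increasing) auto
qed

text \<open>
  Both halves of the cut-off are compared with the same denominator: the first contains it as a
  factor, and the second is below its lower bound by a factor \<open>exp (- \<delta> r\<^sup>2)\<close>.
\<close>

lemma gaussian_mixture_ratio_bound:
  fixes P :: "'a::euclidean_space measure"
  assumes K: "0 < K" "K < \<sigma>" and sub: "subgaussian K P"
  defines "a \<equiv> 1 / (2 * \<sigma>\<^sup>2)"
  obtains C \<delta> where "0 < C" "0 < \<delta>" and
    "\<And>y. (\<integral>\<^sup>+ s. ennreal (exp (- 2 * (a * (norm (y - s))\<^sup>2))) \<partial>P)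
      \<le> ennreal (C * exp (- \<delta> * (norm (y - (\<integral>x. x \<partial>P)))\<^sup>2)) *
        (\<integral>\<^sup>+ s. ennreal (exp (- a * (norm (y - s))\<^sup>2)) \<partial>P)"
proof -
  have P: "prob_space P" and sets[measurable_cong]: "sets P = sets borel"
    using sub by (auto simp: subgaussian_def)
  define m where "m = (\<integral>x. x \<partial>P)"
  \<comment> \<open>This \<open>N\<close> puts the decay rate of the \<open>N\<close>-th power at \<open>1 / (\<sigma>\<^sup>2 + K\<^sup>2)\<close>, strictly
    above \<open>a = 1 / (2 \<sigma>\<^sup>2)\<close>. The excess is split into \<open>N\<close> equal shares \<open>\<delta>\<close>: \<open>N - 2\<close> of them
    absorb the factor \<open>w\<^sup>2\<^sup>-\<^sup>N\<close>, one is the slack in the lower bound of the denominator, and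
    one remains as decay.\<close>
  define N where "N = 2 * \<sigma>\<^sup>2 / (\<sigma>\<^sup>2 - K\<^sup>2)"
  define \<delta> where "\<delta> = (1 / (\<sigma>\<^sup>2 + K\<^sup>2) - a) / N"
  have K2: "0 < K\<^sup>2" "K\<^sup>2 < \<sigma>\<^sup>2"
    using K by (auto intro: power_strict_mono)
  have a: "0 < a" using K by (simp add: a_def)
  have N: "2 \<le> N" using K2 by (simp add: N_def field_simps)
  have Na: "N * a = 1 / (\<sigma>\<^sup>2 - K\<^sup>2)" using K K2 by (simp add: N_def a_def)
  have "a < 1 / (\<sigma>\<^sup>2 + K\<^sup>2)"
    unfolding a_def using K2 by (intro divide_strict_left_mono mult_pos_pos add_pos_pos) linarith+
  then have \<delta>: "0 < \<delta>" using N by (simp add: \<delta>_def)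
  have B: "1 / (\<sigma>\<^sup>2 + K\<^sup>2) = a + N * \<delta>" using N by (simp add: \<delta>_def)
  obtain q where q: "0 < q" and lower: "\<And>y. ennreal (q * exp (- (a + \<delta>) * (norm (y - m))\<^sup>2))
      \<le> (\<integral>\<^sup>+ s. ennreal (exp (- a * (norm (y - s))\<^sup>2)) \<partial>P)"
    using exp_neg_norm_sq_integral_ge[OF P sets a, of "a + \<delta>" m] \<delta> by auto
  define D where "D y = (\<integral>\<^sup>+ s. ennreal (exp (- a * (norm (y - s))\<^sup>2)) \<partial>P)" for y
  define w where "w y = exp (- \<delta> * (norm (y - m))\<^sup>2)" for y
  have "(\<integral>\<^sup>+ s. ennreal (exp (- 2 * (a * (norm (y - s))\<^sup>2))) \<partial>P) \<le> ennreal ((1 + 1 / q) * w y) * D y" for y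
  proof -
    let ?r = "(norm (y - m))\<^sup>2"
    have upper: "(\<integral>\<^sup>+ s. ennreal (exp (- (N * a) * (norm (y - s))\<^sup>2)) \<partial>P) \<le> ennreal (exp (- (a + N * \<delta>) * ?r))"
      using subgaussian_exp_neg_norm_sq_le[OF sub, of "N * a" y] K2
      unfolding B[symmetric] m_def Na by (simp add: add.commute)
    have "(\<integral>\<^sup>+ s. ennreal (exp (- 2 * (a * (norm (y - s))\<^sup>2))) \<partial>P)
        \<le> (\<integral>\<^sup>+ s. ennreal (w y) * ennreal (exp (- a * (norm (y - s))\<^sup>2)) +
             ennreal (exp ((N - 2) * (\<delta> * ?r))) * ennreal (exp (- (N * a) * (norm (y - s))\<^sup>2)) \<partial>P)"
    proof (intro nn_integral_mono)
      fix s
      show "ennreal (exp (- 2 * (a * (norm (y - s))\<^sup>2)))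
        \<le> ennreal (w y) * ennreal (exp (- a * (norm (y - s))\<^sup>2)) +
             ennreal (exp ((N - 2) * (\<delta> * ?r))) * ennreal (exp (- (N * a) * (norm (y - s))\<^sup>2))"
        using exp_cutoff_le[OF N, of "a * (norm (y - s))\<^sup>2" "\<delta> * ?r"]
        by (simp add: w_def ennreal_mult'[symmetric] ennreal_plus[symmetric] mult.assoc del: ennreal_plus)
    qed
    also have "\<dots> = ennreal (w y) * D y +
        ennreal (exp ((N - 2) * (\<delta> * ?r))) * (\<integral>\<^sup>+ s. ennreal (exp (- (N * a) * (norm (y - s))\<^sup>2)) \<partial>P)"
      unfolding D_def by (subst nn_integral_add, measurable) (subst (1 2) nn_integral_cmult; simp)
    also have "\<dots> \<le> ennreal (w y) * D y + ennreal (w y / q) * ennreal (q * exp (- (a + \<delta>) * ?r))"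
    proof -
      have "ennreal (exp ((N - 2) * (\<delta> * ?r))) * ennreal (exp (- (a + N * \<delta>) * ?r))
          = ennreal (w y / q) * ennreal (q * exp (- (a + \<delta>) * ?r))"
        using q by (simp add: w_def ennreal_mult'[symmetric] exp_add[symmetric]) (simp add: algebra_simps)
      then show ?thesis
        using mult_left_mono[OF upper, of "ennreal (exp ((N - 2) * (\<delta> * ?r)))"] by (simp add: add_left_mono)
    qed
    also have "\<dots> \<le> ennreal (w y) * D y + ennreal (w y / q) * D y"
      using lower[of y] by (intro add_left_mono mult_left_mono) (auto simp: D_def)
    also have "\<dots> = ennreal ((1 + 1 / q) * w y) * D y"
    proof -
      have "(1 + 1 / q) * w y = w y + w y / q" "0 \<le> w y"
        by (simp_all add: w_def algebra_simps)
      then show ?thesis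
        using q by (simp add: distrib_right)
    qed
    finally show ?thesis .
  qed
  then show ?thesis
    using q \<delta> by (intro that[of "1 + 1 / q" \<delta>]) (auto simp: w_def D_def m_def add_pos_pos)
qed

section \<open>Finiteness of the information\<close>

theorem proposition1:
  fixes K \<sigma> :: real
    and P :: "(real ^ 'n) measure"
    and M :: "'m measure"
    and S Z Y :: "'m \<Rightarrow> real ^ 'n"
  assumes "0 < K" and "K < \<sigma>"
    and "subgaussian K P"
    and "prob_space M"
    and "prob_space.indep_var M borel S borel Z"
    and "distr M borel S = P"
    and "distr M borel Z = isotropic_gaussian \<sigma>"
    and "Y = (\<lambda>w. S w + Z w)"
  shows "chi2_mutual_information M borel borel S Y < \<infinity>"
proof -
  define a where "a = 1 / (2 * \<sigma>\<^sup>2)"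
  define c where "c = (1 / sqrt (2 * pi * \<sigma>\<^sup>2)) ^ DIM(real ^ 'n)"
  define g where "g x = ennreal c * ennreal (exp (- a * (norm x)\<^sup>2))" for x :: "real ^ 'n"
  have c: "0 < c" and a: "0 \<le> a"
    using assms(1,2) by (auto simp: c_def a_def)
  have sets[measurable_cong]: "sets P = sets borel"
    using assms(3) by (simp add: subgaussian_def)
  have gauss: "isotropic_gaussian \<sigma> = density lborel g"
    unfolding isotropic_gaussian_def prod_normal_density_eq g_def a_def c_def
    by (simp add: ennreal_mult')
  obtain C \<delta> where C: "0 < C" "0 < \<delta>" and le:
    "\<And>y. (\<integral>\<^sup>+ s. ennreal (exp (- 2 * (a * (norm (y - s))\<^sup>2))) \<partial>P)
      \<le> ennreal (C * exp (- \<delta> * (norm (y - (\<integral>x. x \<partial>P)))\<^sup>2)) *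
        (\<integral>\<^sup>+ s. ennreal (exp (- a * (norm (y - s))\<^sup>2)) \<partial>P)"
    using gaussian_mixture_ratio_bound[OF assms(1-3)] unfolding a_def by metis
  define w where "w y = ennreal (exp (- \<delta> * (norm (y - (\<integral>x. x \<partial>P)))\<^sup>2))" for y
  have ratio: "(\<integral>\<^sup>+ s. (g (y - s))\<^sup>2 \<partial>P) / (\<integral>\<^sup>+ s. g (y - s) \<partial>P) \<le> ennreal (c * C) * w y" for y
  proof (rule divide_le_posI_ennreal)
    show "0 < (\<integral>\<^sup>+ s. g (y - s) \<partial>P)"
      using c assms(3) by (intro prob_space.nn_integral_pos)
        (auto simp: g_def ennreal_zero_less_mult_iff subgaussian_def)
    have "(g (y - s))\<^sup>2 = ennreal (c\<^sup>2) * ennreal (exp (- 2 * (a * (norm (y - s))\<^sup>2)))" for s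
      using c by (simp add: g_def power_mult_distrib ennreal_power exp_double[symmetric])
    then have "(\<integral>\<^sup>+ s. (g (y - s))\<^sup>2 \<partial>P) = ennreal (c\<^sup>2) * (\<integral>\<^sup>+ s. ennreal (exp (- 2 * (a * (norm (y - s))\<^sup>2))) \<partial>P)"
      by (simp add: nn_integral_cmult)
    also have "\<dots> \<le> ennreal (c\<^sup>2) * (ennreal (C * exp (- \<delta> * (norm (y - (\<integral>x. x \<partial>P)))\<^sup>2)) *
        (\<integral>\<^sup>+ s. ennreal (exp (- a * (norm (y - s))\<^sup>2)) \<partial>P))"
      by (intro mult_left_mono le) simp
    also have "\<dots> = (\<integral>\<^sup>+ s. g (y - s) \<partial>P) * (ennreal (c * C) * w y)"
      using c C by (simp add: g_def w_def nn_integral_cmult ennreal_mult power2_eq_square ac_simps)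
    finally show "(\<integral>\<^sup>+ s. (g (y - s))\<^sup>2 \<partial>P) \<le> (\<integral>\<^sup>+ s. g (y - s) \<partial>P) * (ennreal (c * C) * w y)" .
  qed
  have "(\<integral>\<^sup>+ y. (\<integral>\<^sup>+ s. (g (y - s))\<^sup>2 \<partial>P) / (\<integral>\<^sup>+ s. g (y - s) \<partial>P) \<partial>lborel)
      \<le> (\<integral>\<^sup>+ y. ennreal (c * C) * w y \<partial>lborel)"
    by (intro nn_integral_mono ratio)
  also have "\<dots> = ennreal (c * C) * (\<integral>\<^sup>+ y. w y \<partial>lborel)"
    unfolding w_def by (intro nn_integral_cmult) measurable
  also have "\<dots> < \<infinity>"
    using nn_integral_exp_neg_norm_sq_finite[OF C(2), of "\<integral>x. x \<partial>P"] unfolding w_def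
    by (simp add: ennreal_mult_less_top)
  finally have fin: "(\<integral>\<^sup>+ y. (\<integral>\<^sup>+ s. (g (y - s))\<^sup>2 \<partial>P) / (\<integral>\<^sup>+ s. g (y - s) \<partial>P) \<partial>lborel) < \<infinity>" (is "?I < _") .
  have "chi2_mutual_information M borel borel S Y = enn2ereal ?I - 1"
    unfolding assms(8)
  proof (rule chi2_mutual_information_additive_noise)
    show "distr M borel Z = density lborel g"
      using assms(7) gauss by simp
    show "0 < g x" for x
      using c by (simp add: g_def ennreal_zero_less_mult_iff)
    show "g x \<le> ennreal c" for x
      using c a unfolding g_def by (subst ennreal_mult'[symmetric]) (auto intro!: ennreal_leI mult_left_le)
  qed (use assms in \<open>auto simp: g_def\<close>)
  also have "\<dots> < \<infinity>"
    using fin by (cases ?I) (auto simp: enn2ereal_ennreal one_ereal_def)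
  finally show ?thesis .
qed
end
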